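(* Let $\mathscr{F}^3=\{[0),[1),[2)\}$. Then the monoid $\boldsymbol{End}_*^1(\boldsymbol{B}_{\omega}^{\mathscr{F}^3})$ of all injective monoid endomorphisms of the semigroup $\boldsymbol{B}_{\omega}^{\mathscr{F}^3}$ (with composition of maps as the operation) is isomorphic to $(\mathbb{N},\cdot)$, the multiplicative semigroup of positive integers.
   Context: $\omega$ is the set of non-negative integers; $\mathbb{N}$ is the set of positive integers; for $a\in\omega$, $[a)=\{x\in\omega\colon x\geqslant a\}$. For $F\subseteq\omega$ nonempty and an integer $n$, $n+F=\{n+k\colon k\in F\}$ (a set of integers). Let $\mathscr{F}^3=\{[0),[1),[2)\}$. The semigroup $\boldsymbol{B}_{\omega}^{\mathscr{F}^3}$ is the set $\omega\times\omega\times\mathscr{F}^3$ with the associative operation $$(i_1,j_1,F_1)\cdot(i_2,j_2,F_2)=\begin{cases}(i_1-j_1+i_2,\,j_2,\,(j_1-i_2+F_1)\cap F_2), & \text{if } j_1\leqslant i_2;\\ (i_1,\,j_1-i_2+j_2,\,F_1\cap(i_2-j_1+F_2)), & \text{if } j_1\geqslant i_2.\end{cases}$$ It is a monoid with identity $(0,0,[0))$. An endomorphism of a semigroup $S$ is a homomorphism $S\to S$; it is a monoid endomorphism if it fixes the identity. *)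

theory Defs
  imports "HOL-Algebra.Group"
begin

definition shift :: "int \<Rightarrow> nat set \<Rightarrow> int set" where
  "shift n F = {n + int k | k. k \<in> F}"

text \<open>A shift is a set of integers that may contain negative numbers. Intersecting it with a
  subset of \<open>\<omega>\<close> discards them, which is what taking the preimage under \<^const>\<open>int\<close> expresses.
  The natural-number subtractions below are never truncated, and the two branches agree
  when \<open>j1 = i2\<close>.\<close>

fun B_mult :: "nat \<times> nat \<times> nat set \<Rightarrow> nat \<times> nat \<times> nat set \<Rightarrow> nat \<times> nat \<times> nat set" where
  "B_mult (i1, j1, F1) (i2, j2, F2) =
     (if j1 \<le> i2
      then ((i1 + i2) - j1, j2, (int -` shift (int j1 - int i2) F1) \<inter> F2)
      else (i1, (j1 + j2) - i2, F1 \<inter> (int -` shift (int i2 - int j1) F2)))"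

definition F3 :: "nat set set" where
  "F3 = {{0..}, {1..}, {2..}}"

definition B_F3 :: "(nat \<times> nat \<times> nat set) monoid" where
  "B_F3 = \<lparr>carrier = UNIV \<times> UNIV \<times> F3, mult = B_mult, one = (0, 0, {0..})\<rparr>"

text \<open>Self-maps of the carrier are represented by functions that are \<^const>\<open>undefined\<close> outside
  it, so that equality of maps is equality of functions.\<close>

definition inj_monoid_endos :: "('a, 'b) monoid_scheme \<Rightarrow> ('a \<Rightarrow> 'a) set" where
  "inj_monoid_endos S =
     {f \<in> extensional (carrier S). f \<in> hom S S \<and> inj_on f (carrier S) \<and> f \<one>\<^bsub>S\<^esub> = \<one>\<^bsub>S\<^esub>}"

definition inj_End_monoid :: "('a, 'b) monoid_scheme \<Rightarrow> ('a \<Rightarrow> 'a) monoid" where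
  "inj_End_monoid S =
     \<lparr>carrier = inj_monoid_endos S, mult = compose (carrier S), one = (\<lambda>x\<in>carrier S. x)\<rparr>"

definition pos_mult_monoid :: "nat monoid" where
  "pos_mult_monoid = \<lparr>carrier = {n. 0 < n}, mult = (*), one = 1\<rparr>"

lemma B_mult_rays:
  "B_mult (i1, j1, {a..}) (i2, j2, {b..}) =
     (if j1 \<le> i2 then (i1 + i2 - j1, j2, {max (a + j1 - i2) b..})
      else (i1, j1 + j2 - i2, {max a (b + i2 - j1)..}))"
proof -
  have *: "int -` shift (int m - int n) {c..} = {c + m - n..}" for m n c :: nat
  proof (rule Set.set_eqI)
    fix x :: nat
    have "(\<exists>k. int x = int m - int n + int k \<and> c \<le> k) \<longleftrightarrow> c + m - n \<le> x"
      by presburger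
    then show "x \<in> int -` shift (int m - int n) {c..} \<longleftrightarrow> x \<in> {c + m - n..}"
      by (simp add: shift_def)
  qed
  show ?thesis
    by (auto simp: *)
qed

lemma max_diff_distrib_right: "max p q - r = max (p - r) (q - r)" for p q r :: nat
  by simp

lemma B_mult_assoc_rays:
  "B_mult (B_mult (i1, j1, {a..}) (i2, j2, {b..})) (i3, j3, {c..}) =
   B_mult (i1, j1, {a..}) (B_mult (i2, j2, {b..}) (i3, j3, {c..}))"
proof (cases "j1 \<le> i2"; cases "j2 \<le> i3")
  assume le: "j1 \<le> i2" "j2 \<le> i3"
  then have "max (max (a + j1 - i2) b + j2 - i3) c =
      max (a + j1 - (i2 + i3 - j2)) (max (b + j2 - i3) c)"
      by (auto simp: not_le max.assoc max_diff_distrib_right max_add_distrib_left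
          elim!: le_Suc_ex[elim_format] less_imp_Suc_add[elim_format])
  moreover have "j1 \<le> i2 + i3 - j2" "i1 + i2 - j1 + i3 - j2 = i1 + (i2 + i3 - j2) - j1"
    using le by linarith+
  ultimately show ?thesis
    using le by (simp only: B_mult_rays if_True if_False)
next
  assume "j1 \<le> i2" "\<not> j2 \<le> i3"
  then show ?thesis
    by (simp add: B_mult_rays del: B_mult.simps)
next
  assume le: "\<not> j1 \<le> i2" "j2 \<le> i3"
  show ?thesis
  proof (cases "j1 + j2 \<le> i2 + i3")
    case True
    with le have "max (max a (b + i2 - j1) + (j1 + j2 - i2) - i3) c =
        max (a + j1 - (i2 + i3 - j2)) (max (b + j2 - i3) c)"
      by (auto simp: not_le max.assoc max_diff_distrib_right max_add_distrib_left
          elim!: le_Suc_ex[elim_format] less_imp_Suc_add[elim_format])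
    moreover have "j1 + j2 - i2 \<le> i3" "j1 \<le> i2 + i3 - j2"
      "i1 + i3 - (j1 + j2 - i2) = i1 + (i2 + i3 - j2) - j1"
      using le True by linarith+
    ultimately show ?thesis
      using le by (simp only: B_mult_rays if_True if_False)
  next
    case False
    have "max (max a (b + i2 - j1)) (c + i3 - (j1 + j2 - i2)) =
        max a (max (b + j2 - i3) c + (i2 + i3 - j2) - j1)"
      using le False
      by (auto simp: not_le max.assoc max_diff_distrib_right
          elim!: le_Suc_ex[elim_format] less_imp_Suc_add[elim_format])
    moreover have "\<not> j1 + j2 - i2 \<le> i3" "\<not> j1 \<le> i2 + i3 - j2"
      "j1 + j2 - i2 + j3 - i3 = j1 + j3 - (i2 + i3 - j2)"
      using le False by linarith+
    ultimately show ?thesis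
      using le by (simp only: B_mult_rays if_True if_False)
  qed
next
  assume le: "\<not> j1 \<le> i2" "\<not> j2 \<le> i3"
  then have "max (max a (b + i2 - j1)) (c + i3 - (j1 + j2 - i2)) =
      max a (max b (c + i3 - j2) + i2 - j1)"
      by (auto simp: not_le max.assoc max_diff_distrib_right add.commute
          elim!: le_Suc_ex[elim_format] less_imp_Suc_add[elim_format])
  moreover have "\<not> j1 + j2 - i2 \<le> i3" "j1 + j2 - i2 + j3 - i3 = j1 + (j2 + j3 - i3) - i2"
    using le by linarith+
  ultimately show ?thesis
    using le by (simp only: B_mult_rays if_True if_False)
qed

lemma F3_cases:
  assumes "F \<in> F3"
  obtains a where "a \<le> 2" "F = {a..}"
  using assms unfolding F3_def by force

lemma ray_in_F3: "a \<le> 2 \<Longrightarrow> {a..} \<in> F3"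
  unfolding F3_def by (cases "a = 0 \<or> a = 1 \<or> a = 2") auto

lemma monoid_B_F3: "monoid B_F3"
proof (rule monoidI)
  fix x y assume "x \<in> carrier B_F3" "y \<in> carrier B_F3"
  then obtain i j a i' j' a' where "x = (i, j, {a..})" "y = (i', j', {a'..})" "a \<le> 2" "a' \<le> 2"
    by (cases x; cases y) (auto simp: B_F3_def elim!: F3_cases)
  then show "x \<otimes>\<^bsub>B_F3\<^esub> y \<in> carrier B_F3"
    by (auto simp: B_F3_def B_mult_rays simp del: B_mult.simps intro!: ray_in_F3)
next
  fix x y z assume "x \<in> carrier B_F3" "y \<in> carrier B_F3" "z \<in> carrier B_F3"
  then show "x \<otimes>\<^bsub>B_F3\<^esub> y \<otimes>\<^bsub>B_F3\<^esub> z = x \<otimes>\<^bsub>B_F3\<^esub> (y \<otimes>\<^bsub>B_F3\<^esub> z)"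
    by (cases x; cases y; cases z)
      (auto simp: B_F3_def B_mult_assoc_rays simp del: B_mult.simps elim!: F3_cases)
next
  show "\<one>\<^bsub>B_F3\<^esub> \<in> carrier B_F3"
    by (auto simp: B_F3_def F3_def)
next
  fix x assume "x \<in> carrier B_F3"
  then obtain i j a where x: "x = (i, j, {a..})"
    by (cases x) (auto simp: B_F3_def elim!: F3_cases)
  show "\<one>\<^bsub>B_F3\<^esub> \<otimes>\<^bsub>B_F3\<^esub> x = x" "x \<otimes>\<^bsub>B_F3\<^esub> \<one>\<^bsub>B_F3\<^esub> = x"
    by (simp_all only: x B_F3_def monoid.simps partial_object.simps B_mult_rays) simp_all
qed

lemma monoid_inj_End_monoid:
  assumes "monoid S"
  shows "monoid (inj_End_monoid S)"
proof -
  interpret monoid S by fact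
  show ?thesis
  proof (rule monoidI)
    fix f g assume "f \<in> carrier (inj_End_monoid S)" "g \<in> carrier (inj_End_monoid S)"
    then have fg: "f \<in> inj_monoid_endos S" "g \<in> inj_monoid_endos S"
      by (simp_all add: inj_End_monoid_def)
    have "inj_on f (g ` carrier S)"
      using fg by (auto simp: inj_monoid_endos_def hom_def intro: inj_on_subset)
    then have "inj_on (compose (carrier S) f g) (carrier S)"
      using fg by (auto simp: inj_monoid_endos_def compose_def inj_on_def)
    moreover have "compose (carrier S) f g \<in> hom S S"
      using fg by (auto simp: inj_monoid_endos_def hom_def compose_def Pi_iff)
    ultimately show "f \<otimes>\<^bsub>inj_End_monoid S\<^esub> g \<in> carrier (inj_End_monoid S)"
      using fg by (simp add: inj_End_monoid_def inj_monoid_endos_def compose_def)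
  next
    show "\<one>\<^bsub>inj_End_monoid S\<^esub> \<in> carrier (inj_End_monoid S)"
      by (auto simp: inj_End_monoid_def inj_monoid_endos_def hom_def inj_on_def)
  next
    fix f g h assume "f \<in> carrier (inj_End_monoid S)" "g \<in> carrier (inj_End_monoid S)"
      "h \<in> carrier (inj_End_monoid S)"
    then show "f \<otimes>\<^bsub>inj_End_monoid S\<^esub> g \<otimes>\<^bsub>inj_End_monoid S\<^esub> h =
        f \<otimes>\<^bsub>inj_End_monoid S\<^esub> (g \<otimes>\<^bsub>inj_End_monoid S\<^esub> h)"
      by (auto simp: inj_End_monoid_def inj_monoid_endos_def hom_def compose_def Pi_iff
          restrict_def)
  next
    fix f assume "f \<in> carrier (inj_End_monoid S)"
    then show "\<one>\<^bsub>inj_End_monoid S\<^esub> \<otimes>\<^bsub>inj_End_monoid S\<^esub> f = f"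
      "f \<otimes>\<^bsub>inj_End_monoid S\<^esub> \<one>\<^bsub>inj_End_monoid S\<^esub> = f"
      by (auto simp: inj_End_monoid_def inj_monoid_endos_def hom_def compose_def Pi_iff
          extensional_def fun_eq_iff)
  qed
qed

end

(* Writing [a] for the ray from a, an injective monoid endomorphism f sends (0,1,[0]) to an
   element with a right inverse, hence to some (0,k,[0]) with k > 0. The idempotents (i,i,[a])
   form a semilattice under componentwise maximum of the pairs (i,i+a), and in it the element
   (0,0,[1]) lies above (1,1,[0]), while (0,0,[2]) and (1,1,[0]) meet in (1,1,[1]). The images
   satisfy the corresponding relations with (k,k,[0]), and injectivity leaves only (0,0,[1]) for f
   (0,0,[1]) and (k-1,k-1,[2]) for f (0,0,[2]). So f is determined by k; conversely each k > 0
   occurs, and composition multiplies the parameters. *)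

theory Submission imports Defs begin

text \<open>Keeping the ray \<open>{a..}\<close> under a constant prevents the simplifier from turning \<open>{0..}\<close>
  into \<open>UNIV\<close>.\<close>

definition ray_elt :: "nat \<Rightarrow> nat \<Rightarrow> nat \<Rightarrow> nat \<times> nat \<times> nat set" where
  "ray_elt i j a = (i, j, {a..})"

lemma ray_elt_eq_iff [simp]: "ray_elt i j a = ray_elt i' j' a' \<longleftrightarrow> i = i' \<and> j = j' \<and> a = a'"
  by (simp add: ray_elt_def)

lemma ray_elt_in_carrier [simp]: "a \<le> 2 \<Longrightarrow> ray_elt i j a \<in> carrier B_F3"
  by (simp add: ray_elt_def B_F3_def ray_in_F3)

lemma carrier_B_F3_cases:
  assumes "x \<in> carrier B_F3"
  obtains i j a where "a \<le> 2" "x = ray_elt i j a"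
  using assms by (cases x) (auto simp: B_F3_def ray_elt_def elim!: F3_cases)

lemma one_B_F3: "\<one>\<^bsub>B_F3\<^esub> = ray_elt 0 0 0"
  by (simp add: B_F3_def ray_elt_def)

lemma mult_ray_elt:
  "ray_elt i1 j1 a \<otimes>\<^bsub>B_F3\<^esub> ray_elt i2 j2 b =
     (if j1 \<le> i2 then ray_elt (i1 + i2 - j1) j2 (max (a + j1 - i2) b)
      else ray_elt i1 (j1 + j2 - i2) (max a (b + i2 - j1)))"
  unfolding ray_elt_def B_F3_def monoid.simps B_mult_rays by simp

text \<open>Reduces an endomorphism to its values on the powers of (1,0,[0]) and (0,1,[0]) and on
  the three elements \<open>ray_elt 0 0 a\<close>.\<close>

lemma ray_elt_decomp:
  "ray_elt i j a = ray_elt i 0 0 \<otimes>\<^bsub>B_F3\<^esub> ray_elt 0 0 a \<otimes>\<^bsub>B_F3\<^esub> ray_elt 0 j 0"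
  by (simp add: mult_ray_elt)

section \<open>Dilations as injective monoid endomorphisms\<close>

definition ray_offset :: "nat \<Rightarrow> nat set \<Rightarrow> nat" where
  "ray_offset k F = (if F = {2..} then k - 1 else 0)"

text \<open>The offset on [2] is forced: (0,0,[2]) and (1,1,[0]) meet in (1,1,[1]), which goes to
  (k,k,[1]), so the image of (0,0,[2]) must have endpoint \<open>i + a\<close> equal to k + 1, which
  gives (k-1,k-1,[2]).\<close>

definition dilation :: "nat \<Rightarrow> nat \<times> nat \<times> nat set \<Rightarrow> nat \<times> nat \<times> nat set" where
  "dilation k =
     (\<lambda>(i, j, F)\<in>carrier B_F3. (k * i + ray_offset k F, k * j + ray_offset k F, F))"

lemma dilation_ray_elt:
  assumes "a \<le> 2"
  shows "dilation k (ray_elt i j a) =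
    ray_elt (k * i + (if a = 2 then k - 1 else 0)) (k * j + (if a = 2 then k - 1 else 0)) a"
  using ray_elt_in_carrier[OF assms, of i j]
  by (simp add: dilation_def ray_elt_def ray_offset_def)

lemma dilation_extensional: "dilation k \<in> extensional (carrier B_F3)"
  by (simp add: dilation_def)

lemma dilation_mult:
  assumes "0 < k" "a \<le> 2" "b \<le> 2"
  shows "dilation k (ray_elt i1 j1 a \<otimes>\<^bsub>B_F3\<^esub> ray_elt i2 j2 b) =
    dilation k (ray_elt i1 j1 a) \<otimes>\<^bsub>B_F3\<^esub> dilation k (ray_elt i2 j2 b)"
proof -
  obtain m where k: "k = Suc m"
    using assms(1) gr0_implies_Suc by blast
  have a: "a = 0 \<or> a = 1 \<or> a = 2" and b: "b = 0 \<or> b = 1 \<or> b = 2"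
    using assms by linarith+
  \<comment> \<open>The gap \<open>d\<close> between \<open>j1\<close> and \<open>i2\<close> enters
    the third coordinate through \<open>a - d\<close> or \<open>b - d\<close>. Both vanish once
    \<open>d\<close> is at least 2, so three cases decide every maximum.\<close>
  have split: "d = 0 \<or> d = 1 \<or> (\<exists>e. d = e + 2)" for d :: nat
    by presburger
  show ?thesis
  proof (cases "j1 \<le> i2")
    case True
    then obtain d where d: "i2 = j1 + d"
      using le_Suc_ex by blast
    show ?thesis
      using a b split[of d] unfolding d k
      by (elim disjE exE) (simp_all add: mult_ray_elt dilation_ray_elt algebra_simps)
  next
    case False
    then obtain d where d: "j1 = i2 + d" "d \<noteq> 0"
      using le_Suc_ex[of i2 j1] by auto
    show ?thesis
      using a b split[of d] d(2) unfolding d(1) k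
      by (elim disjE exE) (simp_all add: mult_ray_elt dilation_ray_elt algebra_simps)
  qed
qed

lemma dilation_in_inj_monoid_endos:
  assumes "0 < k"
  shows "dilation k \<in> inj_monoid_endos B_F3"
  unfolding inj_monoid_endos_def
proof (intro CollectI conjI)
  show "dilation k \<in> extensional (carrier B_F3)"
    by (rule dilation_extensional)
  show "dilation k \<in> hom B_F3 B_F3"
    using assms
    by (auto simp: dilation_mult dilation_ray_elt intro!: homI elim!: carrier_B_F3_cases)
  \<comment> \<open>The third coordinate is preserved, and on each fixed ray both other coordinates
    are affine with slope \<open>k > 0\<close>.\<close>
  show "inj_on (dilation k) (carrier B_F3)"
  proof (rule inj_onI)
    fix x y assume "x \<in> carrier B_F3" "y \<in> carrier B_F3" "dilation k x = dilation k y"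
    then show "x = y"
      using assms by (elim carrier_B_F3_cases) (auto simp: dilation_ray_elt)
  qed
  show "dilation k \<one>\<^bsub>B_F3\<^esub> = \<one>\<^bsub>B_F3\<^esub>"
    by (simp add: one_B_F3 dilation_ray_elt)
qed

lemma dilation_compose:
  assumes "0 < k" "0 < l"
  shows "compose (carrier B_F3) (dilation k) (dilation l) = dilation (k * l)"
proof (rule extensionalityI)
  show "compose (carrier B_F3) (dilation k) (dilation l) \<in> extensional (carrier B_F3)"
    by (simp add: compose_def)
  show "dilation (k * l) \<in> extensional (carrier B_F3)"
    by (rule dilation_extensional)
  fix x assume "x \<in> carrier B_F3"
  then obtain i j a where x: "a \<le> 2" "x = ray_elt i j a"
    by (rule carrier_B_F3_cases)
  \<comment> \<open>Offsets on [2] compose like the parameters: the inner offset is stretched by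
    \<open>k\<close>, then the outer one is added.\<close>
  have "k * (l - 1) + (k - 1) = k * l - 1"
    using assms by (cases k; cases l) auto
  then have "k * (l * n + (l - 1)) + (k - 1) = k * l * n + (k * l - 1)" for n
    by (simp add: add_mult_distrib2)
  then show "compose (carrier B_F3) (dilation k) (dilation l) x = dilation (k * l) x"
    using x by (simp add: compose_def dilation_ray_elt)
qed

section \<open>Classification of the injective monoid endomorphisms\<close>

lemma idempotent_ray_elt:
  assumes "ray_elt i j a \<otimes>\<^bsub>B_F3\<^esub> ray_elt i j a = ray_elt i j a"
  shows "i = j"
  using assms by (auto simp: mult_ray_elt split: if_splits)

text \<open>If \<open>j > i'\<close>, the second coordinate of the product is positive. So
  \<open>j \<le> i'\<close>, and the first coordinate \<open>i + i' - j\<close> vanishes only for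
  \<open>i = 0\<close> and \<open>i' = j\<close>.\<close>

lemma ray_elt_mult_eq_one:
  assumes "ray_elt i j a \<otimes>\<^bsub>B_F3\<^esub> ray_elt i' j' b = ray_elt 0 0 0"
  shows "i = 0" "a = 0" "i' = j" "j' = 0" "b = 0"
  using assms by (auto simp: mult_ray_elt split: if_splits)

lemma inj_monoid_endo_eq_dilation:
  assumes "f \<in> inj_monoid_endos B_F3"
  obtains k where "0 < k" "f = dilation k"
proof -
  have ext: "f \<in> extensional (carrier B_F3)"
    and mult: "\<And>x y. x \<in> carrier B_F3 \<Longrightarrow> y \<in> carrier B_F3 \<Longrightarrow>
      f (x \<otimes>\<^bsub>B_F3\<^esub> y) = f x \<otimes>\<^bsub>B_F3\<^esub> f y"
    and closed: "\<And>x. x \<in> carrier B_F3 \<Longrightarrow> f x \<in> carrier B_F3"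
    and inj: "inj_on f (carrier B_F3)"
    and one: "f (ray_elt 0 0 0) = ray_elt 0 0 0"
    using assms by (auto simp: inj_monoid_endos_def hom_def one_B_F3)
  have image: "\<exists>i' j' a'. a' \<le> 2 \<and> f (ray_elt i j a) = ray_elt i' j' a'" if "a \<le> 2" for i j a
    using closed[of "ray_elt i j a"] that by (auto elim: carrier_B_F3_cases)
  have neq: "f (ray_elt i j a) \<noteq> f (ray_elt i' j' a')"
    if "a \<le> 2" "a' \<le> 2" "(i, j, a) \<noteq> (i', j', a')" for i j a i' j' a'
    using inj_onD[OF inj, of "ray_elt i j a" "ray_elt i' j' a'"] that by auto
  obtain k where right: "f (ray_elt 0 1 0) = ray_elt 0 k 0"
    and left: "f (ray_elt 1 0 0) = ray_elt k 0 0"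
  proof -
    obtain i j a i' j' b
      where eqs: "f (ray_elt 0 1 0) = ray_elt i j a" "f (ray_elt 1 0 0) = ray_elt i' j' b"
      using image[of 0] by (metis zero_le)
    \<comment> \<open>The bicyclic relation (0,1,[0]) (1,0,[0]) = 1 makes a single \<open>k\<close>
      govern both images.\<close>
    have "f (ray_elt 0 1 0) \<otimes>\<^bsub>B_F3\<^esub> f (ray_elt 1 0 0) = ray_elt 0 0 0"
      using mult[of "ray_elt 0 1 0" "ray_elt 1 0 0"] one by (simp add: mult_ray_elt)
    then show thesis
      using ray_elt_mult_eq_one[of i j a i' j' b] that[of j] eqs by simp
  qed
  have k: "0 < k"
    using neq[of 0 0 0 1 0 0] one right by (cases k) auto
  have left_pow: "f (ray_elt n 0 0) = ray_elt (k * n) 0 0" for n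
  proof (induction n)
    case (Suc n)
    then show ?case
      using mult[of "ray_elt 1 0 0" "ray_elt n 0 0"] left by (simp add: mult_ray_elt)
  qed (simp add: one)
  have right_pow: "f (ray_elt 0 n 0) = ray_elt 0 (k * n) 0" for n
  proof (induction n)
    case (Suc n)
    then show ?case
      using mult[of "ray_elt 0 n 0" "ray_elt 0 1 0"] right one
      by (cases "n = 0") (simp_all add: mult_ray_elt add.commute)
  qed (simp add: one)
  have decomp: "f (ray_elt i j a) =
      ray_elt (k * i) 0 0 \<otimes>\<^bsub>B_F3\<^esub> f (ray_elt 0 0 a) \<otimes>\<^bsub>B_F3\<^esub> ray_elt 0 (k * j) 0"
    if "a \<le> 2" for i j a
  proof -
    have "ray_elt i 0 0 \<otimes>\<^bsub>B_F3\<^esub> ray_elt 0 0 a \<in> carrier B_F3"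
      using that by (simp add: mult_ray_elt)
    then show ?thesis
      unfolding ray_elt_decomp[of i j a] using that by (simp add: mult left_pow right_pow)
  qed
  have idem: "\<exists>p s. s \<le> 2 \<and> f (ray_elt 0 0 a) = ray_elt p p s" if a: "a \<le> 2" for a
  proof -
    obtain i j s where s: "s \<le> 2" "f (ray_elt 0 0 a) = ray_elt i j s"
      using image[OF a] by blast
    have "f (ray_elt 0 0 a) \<otimes>\<^bsub>B_F3\<^esub> f (ray_elt 0 0 a) = f (ray_elt 0 0 a)"
      using mult[of "ray_elt 0 0 a" "ray_elt 0 0 a"] a by (simp add: mult_ray_elt)
    then show ?thesis
      using idempotent_ray_elt[of i j s] s by auto
  qed
  obtain p s where s: "s \<le> 2" and f1: "f (ray_elt 0 0 1) = ray_elt p p s"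
    using idem[of 1] by auto
  obtain q t where t: "t \<le> 2" and f2: "f (ray_elt 0 0 2) = ray_elt q q t"
    using idem[of 2] by auto
  have f11: "f (ray_elt 1 1 0) = ray_elt k k 0"
    using decomp[of 0 1 1] by (simp add: one mult_ray_elt)
  have shift1: "f (ray_elt 1 1 1) = ray_elt (k + p) (k + p) s"
    using decomp[of 1 1 1] f1 by (simp add: mult_ray_elt)
  have "ray_elt p p s \<otimes>\<^bsub>B_F3\<^esub> ray_elt k k 0 = ray_elt k k 0"
    using mult[of "ray_elt 0 0 1" "ray_elt 1 1 0"] f1 f11 by (simp add: mult_ray_elt)
  then have ps: "p + s \<le> k"
    by (auto simp: mult_ray_elt split: if_splits)
  have meet: "ray_elt q q t \<otimes>\<^bsub>B_F3\<^esub> ray_elt k k 0 = ray_elt (k + p) (k + p) s"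
    using mult[of "ray_elt 0 0 2" "ray_elt 1 1 0"] f2 f11 shift1 by (simp add: mult_ray_elt)
  have "(q, t) \<noteq> (k + p, s)"
    using neq[of 2 1 0 0 1 1] f2 shift1 by auto
  moreover have "(p, s) \<noteq> (0, 0)"
    using neq[of 1 0 0 0 0 0] f1 one by auto
  \<comment> \<open>If \<open>q > k\<close>, then \<open>meet\<close> gives \<open>q = k + p\<close>
    and \<open>t = s\<close>, which injectivity excludes. So \<open>q \<le> k\<close>, whence
    \<open>p = 0\<close>, \<open>s > 0\<close> and \<open>q + t = k + s\<close>. Now
    \<open>q = k\<close> would again give \<open>t = s\<close>; thus \<open>q < k\<close> and
    \<open>s < t \<le> 2\<close>, leaving \<open>s = 1\<close>, \<open>t = 2\<close> and
    \<open>q = k - 1\<close>.\<close>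
  ultimately have "p = 0 \<and> s = 1 \<and> q = k - 1 \<and> t = 2"
    using meet ps s t k by (auto simp: mult_ray_elt max_def split: if_splits)
  then have "f (ray_elt i j a) = dilation k (ray_elt i j a)" if "a \<le> 2" for i j a
  proof -
    have "a = 0 \<or> a = 1 \<or> a = 2"
      using that by linarith
    then show ?thesis
      using decomp[OF that, of i j] f1 f2 one \<open>p = 0 \<and> s = 1 \<and> q = k - 1 \<and> t = 2\<close>
      by (auto simp: mult_ray_elt dilation_ray_elt)
  qed
  then have "f = dilation k"
    by (intro extensionalityI[OF ext dilation_extensional]) (elim carrier_B_F3_cases, simp)
  with k that show thesis
    by blast
qed

section \<open>The isomorphism with the positive integers\<close>

lemma inj_on_dilation: "inj_on dilation A"
proof (rule inj_onI)
  fix k l assume "dilation k = dilation l"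
  \<comment> \<open>The second coordinate of the image of (0,1,[0]) is the parameter itself.\<close>
  then have "dilation k (ray_elt 0 1 0) = dilation l (ray_elt 0 1 0)"
    by simp
  then show "k = l"
    by (simp add: dilation_ray_elt)
qed

text \<open>Reverses the natural map \<open>dilation\<close>, which runs from parameters to
  endomorphisms. Closure of \<open>G\<close> places products in the set where
  \<open>inv_into\<close> undoes \<open>h\<close>.\<close>

lemma (in monoid) is_iso_sym:
  assumes "h \<in> iso G H"
  shows "H \<cong> G"
proof -
  have hom: "h \<in> hom G H" and bij: "bij_betw h (carrier G) (carrier H)"
    using assms by (auto simp: iso_def)
  let ?g = "inv_into (carrier G) h"
  have "?g \<in> hom H G"
  proof (rule homI)
    fix x assume "x \<in> carrier H"
    then show "?g x \<in> carrier G"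
      using bij by (simp add: bij_betw_def inv_into_into)
  next
    fix x y assume "x \<in> carrier H" "y \<in> carrier H"
    then have "x \<in> h ` carrier G" "y \<in> h ` carrier G"
      using bij by (simp_all add: bij_betw_def)
    then obtain a b where ab: "a \<in> carrier G" "b \<in> carrier G" "x = h a" "y = h b"
      by blast
    then have "x \<otimes>\<^bsub>H\<^esub> y = h (a \<otimes> b)"
      using hom by (simp add: hom_mult)
    then show "?g (x \<otimes>\<^bsub>H\<^esub> y) = ?g x \<otimes> ?g y"
      using ab bij by (simp add: bij_betw_inv_into_left)
  qed
  then have "?g \<in> iso H G"
    using bij by (simp add: iso_def bij_betw_inv_into)
  then show ?thesis
    by (rule is_isoI)
qed

theorem theorem6: "inj_End_monoid B_F3 \<cong> pos_mult_monoid"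
proof -
  have bij: "bij_betw dilation {k. 0 < k} (inj_monoid_endos B_F3)"
    by (auto simp: bij_betw_def inj_on_dilation dilation_in_inj_monoid_endos
        elim: inj_monoid_endo_eq_dilation)
  have "dilation \<in> iso pos_mult_monoid (inj_End_monoid B_F3)"
    using bij
    by (auto simp: iso_def hom_def pos_mult_monoid_def inj_End_monoid_def dilation_compose
        dilation_in_inj_monoid_endos)
  moreover have "monoid pos_mult_monoid"
    by (rule monoidI) (auto simp: pos_mult_monoid_def)
  ultimately show ?thesis
    by (rule monoid.is_iso_sym[rotated])
qed

end
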